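(* Let $\tau:\mathbb{U}\to\Omega$ be the Riemann map used to define the norm of $H^2(\Omega)$. The reproducing kernels on $H^{2}(\Omega)$ are given by $$k_{u}=\overline{(\tau'(\tau^{-1}(u)))}^{-1/2}\,V^{-1}K_{\tau^{-1}(u)},\quad u\in\Omega.$$ In particular, if $\tau(z)=\frac{az+b}{cz+d}$ for $z\in\mathbb{U}$, where $a,b,c,d\in\mathbb{C}$ and $ad-bc\neq0$, then $$k_{u}(w)=\frac{|ad-bc|}{|a|^{2}-|b|^{2}+(b\overline{d}-\overline{c}a)\overline{u}+[(|c|^{2}-|d|^{2})\overline{u}+\overline{b}d-\overline{a}c]w},\quad u,w\in\Omega.$$
   Context: $\mathbb{U}$ is the open unit disc, $\Omega$ is an open simply connected proper subset of $\mathbb{C}$, and a Riemann map $\tau:\mathbb{U}\to\Omega$ is a biholomorphic map of $\mathbb{U}$ onto $\Omega$. The Hardy-Smirnov space $H^{2}(\Omega)$ is the set of analytic $f:\Omega\to\mathbb{C}$ with $\|f\|^{2}=\sup_{0<r<1}\frac{1}{2\pi}\int_{\Gamma_r}|f(w)|^{2}|dw|<\infty$, where $\Gamma_r=\tau(\{|z|=r\})$. Fix an analytic branch of $(\tau')^{1/2}$ on $\mathbb{U}$ (used consistently; $\overline{(\tau'(z))}^{-1/2}$ means the complex conjugate of $1/(\tau')^{1/2}(z)$). The map $Vf=(f\circ\tau)(\tau')^{1/2}$ is an isometric isomorphism from $H^2(\Omega)$ onto the classical Hardy space $H^2(\mathbb{U})$, and $H^{2}(\Omega)$ is a Hilbert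 space with inner product $\langle f,g\rangle=\langle Vf,Vg\rangle_{2}$, where $\langle\cdot,\cdot\rangle_2$ is the inner product of $H^2(\mathbb{U})$, $\langle F,G\rangle_2=\sum_{n\ge0}\widehat F(n)\overline{\widehat G(n)}$ (Maclaurin coefficients). For $\alpha\in\mathbb{U}$, $K_\alpha(z)=\frac{1}{1-\overline{\alpha}z}$ is the reproducing kernel of $H^2(\mathbb{U})$ at $\alpha$. The reproducing kernel of $H^2(\Omega)$ at $u\in\Omega$ is the function $k_u\in H^2(\Omega)$ with $f(u)=\langle f,k_u\rangle$ for all $f\in H^2(\Omega)$. *)

theory Defs
  imports "HOL-Complex_Analysis.Complex_Analysis"
begin

text \<open>
  A function on a domain \<open>D\<close> is represented by a total function in \<open>extensional D\<close>, so that equality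
  of total functions is equality of functions on \<open>D\<close> and \<open>V\<close> is genuinely injective.
\<close>

abbreviation unit_disc :: "complex set" where
  "unit_disc \<equiv> ball 0 1"

definition riemann_map :: "(complex \<Rightarrow> complex) \<Rightarrow> complex set \<Rightarrow> bool" where
  "riemann_map \<tau> \<Omega> \<longleftrightarrow>
     \<tau> holomorphic_on unit_disc \<and> bij_betw \<tau> unit_disc \<Omega> \<and>
     inv_into unit_disc \<tau> holomorphic_on \<Omega>"

text \<open>The integral of \<open>g\<close> with respect to arc length \<open>|dw|\<close> along the path \<open>\<gamma>\<close>.\<close>

definition arc_length_integral :: "(real \<Rightarrow> complex) \<Rightarrow> (complex \<Rightarrow> real) \<Rightarrow> real" where
  "arc_length_integral \<gamma> g =
     integral {0..1} (\<lambda>t. g (\<gamma> t) * norm (vector_derivative \<gamma> (at t within {0..1})))"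

text \<open>
  The curve \<open>\<Gamma>\<^sub>r\<close> is parametrised by \<open>\<tau> \<circ> circlepath 0 r\<close>, which traverses it once when \<open>\<tau>\<close> is injective.
\<close>

definition hs_norm_sq :: "(complex \<Rightarrow> complex) \<Rightarrow> (complex \<Rightarrow> complex) \<Rightarrow> ennreal" where
  "hs_norm_sq \<tau> f =
     (SUP r\<in>{0<..<1}. ennreal (1 / (2 * pi) *
        arc_length_integral (\<tau> \<circ> circlepath 0 r) (\<lambda>w. (norm (f w))\<^sup>2)))"

definition hardy_smirnov :: "complex set \<Rightarrow> (complex \<Rightarrow> complex) \<Rightarrow> (complex \<Rightarrow> complex) set" where
  "hardy_smirnov \<Omega> \<tau> =
     {f \<in> extensional \<Omega>. f holomorphic_on \<Omega> \<and> hs_norm_sq \<tau> f < \<infinity>}"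

text \<open>The inner product of the classical Hardy space, in terms of Maclaurin coefficients.\<close>

definition hardy_inner :: "(complex \<Rightarrow> complex) \<Rightarrow> (complex \<Rightarrow> complex) \<Rightarrow> complex" where
  "hardy_inner F G =
     (\<Sum>n. fps_nth (fps_expansion F 0) n * cnj (fps_nth (fps_expansion G 0) n))"

definition szego_kernel :: "complex \<Rightarrow> complex \<Rightarrow> complex" where
  "szego_kernel \<alpha> = (\<lambda>z\<in>unit_disc. 1 / (1 - cnj \<alpha> * z))"

text \<open>In the following, \<open>s\<close> is the chosen branch of the square root of \<open>deriv \<tau>\<close>.\<close>

definition sqrt_branch :: "(complex \<Rightarrow> complex) \<Rightarrow> (complex \<Rightarrow> complex) \<Rightarrow> bool" where
  "sqrt_branch s \<tau> \<longleftrightarrow> s holomorphic_on unit_disc \<and> (\<forall>z\<in>unit_disc. (s z)\<^sup>2 = deriv \<tau> z)"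

definition hs_V ::
  "(complex \<Rightarrow> complex) \<Rightarrow> (complex \<Rightarrow> complex) \<Rightarrow> (complex \<Rightarrow> complex) \<Rightarrow> complex \<Rightarrow> complex" where
  "hs_V \<tau> s f = (\<lambda>z\<in>unit_disc. f (\<tau> z) * s z)"

definition hs_V_inv ::
  "complex set \<Rightarrow> (complex \<Rightarrow> complex) \<Rightarrow> (complex \<Rightarrow> complex) \<Rightarrow> (complex \<Rightarrow> complex) \<Rightarrow> complex \<Rightarrow> complex" where
  "hs_V_inv \<Omega> \<tau> s = inv_into (hardy_smirnov \<Omega> \<tau>) (hs_V \<tau> s)"

definition hs_inner ::
  "(complex \<Rightarrow> complex) \<Rightarrow> (complex \<Rightarrow> complex) \<Rightarrow> (complex \<Rightarrow> complex) \<Rightarrow> (complex \<Rightarrow> complex) \<Rightarrow> complex" where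
  "hs_inner \<tau> s f g = hardy_inner (hs_V \<tau> s f) (hs_V \<tau> s g)"

definition is_reproducing_kernel ::
  "complex set \<Rightarrow> (complex \<Rightarrow> complex) \<Rightarrow> (complex \<Rightarrow> complex) \<Rightarrow> complex \<Rightarrow> (complex \<Rightarrow> complex) \<Rightarrow> bool" where
  "is_reproducing_kernel \<Omega> \<tau> s u k \<longleftrightarrow>
     k \<in> hardy_smirnov \<Omega> \<tau> \<and> (\<forall>f\<in>hardy_smirnov \<Omega> \<tau>. f u = hs_inner \<tau> s f k)"

end

theory Submission
  imports Defs
begin

text \<open>
  The multiplier \<open>s\<close> never vanishes, so every bounded holomorphic \<open>F\<close> on the disc is \<open>V f\<close> for the
  explicit \<open>f = (F / s) \<circ> \<tau>\<inverse>\<close>; the Szego kernels are of this kind. Pairing with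
  \<open>K\<^sub>\<alpha>\<close> evaluates the Maclaurin series at \<open>\<alpha>\<close>, which gives the reproducing property. Pairing
  any function that reproduces at \<open>u\<close> with the kernel at \<open>v\<close> determines its value at \<open>v\<close>, hence
  uniqueness. For \<open>w = \<tau> z\<close> with \<open>\<tau>\<close> Moebius, \<open>s z (c z + d)\<close> is a constant square root of \<open>a d - b c\<close>
  and \<open>c z + d = (a d - b c) / (a - c w)\<close>.
\<close>

section \<open>Szego kernels on the unit disc\<close>

text \<open>The geometric series near 0. Only values on the disc are prescribed for
  \<open>G\<close>, which suffices because the expansion at 0 is local.\<close>

lemma fps_expansion_szego_kernel:
  assumes "\<And>z. z \<in> unit_disc \<Longrightarrow> G z = c * szego_kernel \<alpha> z"
  shows "fps_nth (fps_expansion G 0) n = c * cnj \<alpha> ^ n"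
proof -
  define A where "A = Abs_fps (\<lambda>n. c * cnj \<alpha> ^ n)"
  \<comment> \<open>This radius keeps the geometric ratio below 1 in norm for any \<alpha>, and
    \<open>r \<le> 1\<close> keeps the ball inside the disc, where \<open>G\<close> is
    known.\<close>
  define r where "r = 1 / (1 + norm \<alpha>)"
  have r: "0 < r" "r \<le> 1" "norm \<alpha> * r < 1"
    by (auto simp: r_def field_simps add_pos_nonneg)
  have "(\<lambda>n. fps_nth A n * z ^ n) sums G z" if "z \<in> ball 0 r" for z
  proof -
    have "norm (cnj \<alpha> * z) \<le> norm \<alpha> * r"
      using that by (auto simp: norm_mult intro: mult_left_mono)
    then have "(\<lambda>n. (cnj \<alpha> * z) ^ n) sums (1 / (1 - cnj \<alpha> * z))"
      using r by (intro geometric_sums) linarith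
    from sums_mult[OF this, of c] show ?thesis
      using that r assms[of z] by (simp add: A_def szego_kernel_def power_mult_distrib mult.assoc)
  qed
  moreover have "eventually (\<lambda>z::complex. z \<in> ball 0 r) (nhds 0)"
    using r by (intro eventually_nhds_in_open) auto
  ultimately have "G has_fps_expansion A"
    by (intro has_fps_expansionI) (auto elim: eventually_mono)
  then have "fps_expansion G 0 = A"
    by (rule fps_expansion_eqI)
  then show ?thesis
    by (simp add: A_def)
qed

text \<open>Conjugating the coefficients \<open>c * cnj \<alpha> ^ n\<close> of \<open>G\<close>
  turns the inner product into \<open>cnj c\<close> times the Maclaurin series of \<open>F\<close>
  at \<alpha>. The version with swapped arguments is its conjugate; it serves the uniqueness
  proof.\<close>

lemma hardy_inner_szego_kernel:
  assumes F: "F holomorphic_on unit_disc" and \<alpha>: "\<alpha> \<in> unit_disc"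
    and G: "\<And>z. z \<in> unit_disc \<Longrightarrow> G z = c * szego_kernel \<alpha> z"
  shows "hardy_inner F G = cnj c * F \<alpha>" and "hardy_inner G F = c * cnj (F \<alpha>)"
proof -
  have "(\<lambda>n. fps_nth (fps_expansion F 0) n * \<alpha> ^ n) sums F \<alpha>"
    using holomorphic_power_series[OF F \<alpha>] by (simp add: fps_expansion_def)
  moreover have "fps_nth (fps_expansion G 0) n = c * cnj \<alpha> ^ n" for n
    using G by (rule fps_expansion_szego_kernel)
  ultimately
  have *: "(\<lambda>n. fps_nth (fps_expansion F 0) n * cnj (fps_nth (fps_expansion G 0) n)) sums (cnj c * F \<alpha>)"
    using sums_mult[of "\<lambda>n. fps_nth (fps_expansion F 0) n * \<alpha> ^ n" "F \<alpha>" "cnj c"]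
    by (simp add: mult_ac)
  then show "hardy_inner F G = cnj c * F \<alpha>"
    by (simp add: hardy_inner_def sums_iff)
  from *[THEN sums_cnj[THEN iffD2]] show "hardy_inner G F = c * cnj (F \<alpha>)"
    by (simp add: hardy_inner_def sums_iff mult.commute)
qed

lemma szego_kernel_holomorphic:
  assumes "\<alpha> \<in> unit_disc"
  shows "szego_kernel \<alpha> holomorphic_on unit_disc"
proof -
  have "1 - cnj \<alpha> * z \<noteq> 0" if "z \<in> unit_disc" for z
  proof
    assume "1 - cnj \<alpha> * z = 0"
    then have "norm (cnj \<alpha> * z) = 1"
      by simp
    moreover have "norm \<alpha> * norm z < 1 * 1"
      using assms that by (intro mult_strict_mono') auto
    ultimately show False
      by (simp add: norm_mult)
  qed
  then have "(\<lambda>z. 1 / (1 - cnj \<alpha> * z)) holomorphic_on unit_disc"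
    by (intro holomorphic_intros) auto
  then show ?thesis
    by (rule holomorphic_transform) (simp add: szego_kernel_def)
qed

lemma szego_kernel_bounded:
  assumes "\<alpha> \<in> unit_disc" "z \<in> unit_disc"
  shows "norm (szego_kernel \<alpha> z) \<le> 1 / (1 - norm \<alpha>)"
proof -
  have "norm \<alpha> * norm z \<le> norm \<alpha> * 1"
    using assms by (intro mult_left_mono) auto
  moreover have "1 - norm \<alpha> * norm z \<le> norm (1 - cnj \<alpha> * z)"
    using norm_triangle_ineq2[of 1 "cnj \<alpha> * z"] by (simp add: norm_mult)
  ultimately have "1 - norm \<alpha> \<le> norm (1 - cnj \<alpha> * z)"
    by linarith
  then show ?thesis
    using assms by (auto simp: szego_kernel_def norm_divide intro!: divide_left_mono mult_pos_pos)
qed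

section \<open>The Riemann map and injectivity of \<open>V\<close>\<close>

locale hardy_smirnov_domain =
  fixes \<Omega> :: "complex set" and \<tau> s :: "complex \<Rightarrow> complex"
  assumes riemann: "riemann_map \<tau> \<Omega>"
    and sqrt: "sqrt_branch s \<tau>"
begin

abbreviation \<sigma> :: "complex \<Rightarrow> complex" where
  "\<sigma> \<equiv> inv_into unit_disc \<tau>"

lemma hol_\<tau>: "\<tau> holomorphic_on unit_disc" and bij_\<tau>: "bij_betw \<tau> unit_disc \<Omega>"
  and hol_\<sigma>: "\<sigma> holomorphic_on \<Omega>" and hol_s: "s holomorphic_on unit_disc"
  and s_squared: "z \<in> unit_disc \<Longrightarrow> (s z)\<^sup>2 = deriv \<tau> z"
  using riemann sqrt by (auto simp: riemann_map_def sqrt_branch_def)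

lemma \<tau>_in [simp]: "z \<in> unit_disc \<Longrightarrow> \<tau> z \<in> \<Omega>"
  using bij_\<tau> bij_betwE by blast

lemma \<sigma>_in: "w \<in> \<Omega> \<Longrightarrow> \<sigma> w \<in> unit_disc"
  using bij_\<tau> bij_betw_imp_surj_on inv_into_into by metis

lemma \<tau>_\<sigma>: "w \<in> \<Omega> \<Longrightarrow> \<tau> (\<sigma> w) = w"
  using bij_\<tau> by (rule bij_betw_inv_into_right)

lemma \<sigma>_\<tau>: "z \<in> unit_disc \<Longrightarrow> \<sigma> (\<tau> z) = z"
  using bij_\<tau> by (rule bij_betw_inv_into_left)

text \<open>An injective holomorphic map has no critical points, and \<open>s\<close> squares to its
  derivative.\<close>

lemma s_nonzero: "s z \<noteq> 0" if "z \<in> unit_disc"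
  using holomorphic_injective_imp_regular[OF hol_\<tau> open_ball bij_betw_imp_inj_on[OF bij_\<tau>] that]
    s_squared[OF that] by auto

lemma hs_V_holomorphic:
  assumes "f \<in> hardy_smirnov \<Omega> \<tau>"
  shows "hs_V \<tau> s f holomorphic_on unit_disc"
proof -
  have f: "f holomorphic_on \<Omega>"
    using assms by (simp add: hardy_smirnov_def)
  have "(f \<circ> \<tau>) holomorphic_on unit_disc"
    by (rule holomorphic_on_compose_gen[OF hol_\<tau> f]) auto
  then have "(\<lambda>z. (f \<circ> \<tau>) z * s z) holomorphic_on unit_disc"
    using hol_s by (intro holomorphic_intros)
  then show ?thesis
    by (rule holomorphic_transform) (simp add: hs_V_def)
qed

lemma hs_V_eq_imp_eq:
  assumes "hs_V \<tau> s f = hs_V \<tau> s g" and w: "w \<in> \<Omega>"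
  shows "f w = g w"
  using fun_cong[OF assms(1), of "\<sigma> w"] w \<sigma>_in[OF w] s_nonzero[OF \<sigma>_in[OF w]]
  by (simp add: hs_V_def \<tau>_\<sigma>)

text \<open>This makes the \<open>inv_into\<close> in \<open>hs_V_inv\<close> return the preimage
  that one exhibits. Values agree on \<Omega> after division by \<open>s\<close>; extensionality
  settles the values elsewhere.\<close>

lemma inj_on_hs_V: "inj_on (hs_V \<tau> s) (hardy_smirnov \<Omega> \<tau>)"
  by (rule inj_onI, rule extensionalityI[of _ \<Omega>])
     (auto simp: hardy_smirnov_def dest: hs_V_eq_imp_eq)

section \<open>A sufficient condition for membership in the Hardy-Smirnov space\<close>

text \<open>Chain rule, with the modulus of the derivative of \<tau> rewritten as the squared
  modulus of \<open>s\<close>. This turns the arc length integral of \<open>f\<close> into a circle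
  integral of the squared modulus of \<open>hs_V \<tau> s f\<close>.\<close>

lemma norm_vector_derivative_image_circle:
  assumes r: "0 < r" "r < 1" and t: "t \<in> {0..1}"
  shows "norm (vector_derivative (\<tau> \<circ> circlepath 0 r) (at t within {0..1})) =
         2 * pi * r * (norm (s (circlepath 0 r t)))\<^sup>2"
proof -
  define z where "z = circlepath 0 r t"
  have z: "z \<in> unit_disc"
    using r by (simp add: z_def circlepath norm_mult)
  have "(\<tau> has_field_derivative deriv \<tau> z) (at z)"
    using hol_\<tau> z by (intro holomorphic_derivI) auto
  then have "(\<tau> \<circ> circlepath 0 r has_vector_derivative
          2 * pi * \<i> * r * exp (2 * of_real pi * \<i> * t) * deriv \<tau> z) (at t within {0..1})"
    unfolding z_def
    by (rule field_vector_diff_chain_within[OF has_vector_derivative_circlepath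
          has_field_derivative_at_within])
  then have "vector_derivative (\<tau> \<circ> circlepath 0 r) (at t within {0..1}) =
          2 * pi * \<i> * r * exp (2 * of_real pi * \<i> * t) * deriv \<tau> z"
    using t by (intro vector_derivative_within_closed_interval) auto
  then show ?thesis
    using r z by (simp add: norm_mult s_squared[symmetric] norm_power z_def)
qed

text \<open>After the change of variables the integrand is at most \<open>2 * pi * B\<^sup>2\<close>
  on an interval of length 1, uniformly in the radius.\<close>

lemma bounded_imp_in_hardy_smirnov:
  assumes ext: "f \<in> extensional \<Omega>" and hol: "f holomorphic_on \<Omega>"
    and bound: "\<And>z. z \<in> unit_disc \<Longrightarrow> norm (f (\<tau> z) * s z) \<le> B"
  shows "f \<in> hardy_smirnov \<Omega> \<tau>"
proof -
  have "arc_length_integral (\<tau> \<circ> circlepath 0 r) (\<lambda>w. (norm (f w))\<^sup>2) \<le> 2 * pi * B\<^sup>2"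
    if r: "0 < r" "r < 1" for r
  proof -
    define g where "g t = (norm (f ((\<tau> \<circ> circlepath 0 r) t)))\<^sup>2 *
      norm (vector_derivative (\<tau> \<circ> circlepath 0 r) (at t within {0..1}))" for t
    have g: "norm (g t) \<le> 2 * pi * B\<^sup>2" if t: "t \<in> {0..1}" for t
    proof -
      define z where "z = circlepath 0 r t"
      have z: "z \<in> unit_disc"
        using r by (simp add: z_def circlepath norm_mult)
      have "norm (g t) = 2 * pi * (r * (norm (f (\<tau> z) * s z))\<^sup>2)"
        using r by (simp add: g_def norm_vector_derivative_image_circle[OF r t] z_def
            norm_mult power_mult_distrib)
      also have "\<dots> \<le> 2 * pi * (1 * B\<^sup>2)"
        using r bound[OF z] by (intro mult_left_mono mult_mono power_mono) auto
      finally show ?thesis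
        by simp
    qed
    have "integral {0..1} g \<le> 2 * pi * B\<^sup>2"
    proof (cases "g integrable_on {0..1}")
      case True
      then show ?thesis
        using integral_le[OF True, of "\<lambda>_. 2 * pi * B\<^sup>2"] g by fastforce
    next
      \<comment> \<open>Here \<open>integral\<close> takes its default value 0, which the
        nonnegative bound dominates.\<close>
      case False
      then show ?thesis
        by (simp add: not_integrable_integral)
    qed
    then show ?thesis
      by (simp add: arc_length_integral_def g_def[abs_def])
  qed
  then have "hs_norm_sq \<tau> f \<le> ennreal (1 / (2 * pi) * (2 * pi * B\<^sup>2))"
    unfolding hs_norm_sq_def by (intro SUP_least ennreal_leI mult_left_mono) auto
  also have "\<dots> < \<infinity>"
    by simp
  finally show ?thesis
    using ext hol by (simp add: hardy_smirnov_def)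
qed

section \<open>The explicit kernel, its reproducing property and uniqueness\<close>

text \<open>The preimage under \<open>V\<close> of \<open>c\<close> times a Szego kernel. The factor
  \<open>c\<close> lets one membership proof cover both this preimage with \<open>c = 1\<close> and
  the reproducing kernel.\<close>

definition pulled_kernel :: "complex \<Rightarrow> complex \<Rightarrow> complex \<Rightarrow> complex" where
  "pulled_kernel c \<alpha> = (\<lambda>w\<in>\<Omega>. c * szego_kernel \<alpha> (\<sigma> w) / s (\<sigma> w))"

lemma pulled_kernel_mult_s:
  "z \<in> unit_disc \<Longrightarrow> pulled_kernel c \<alpha> (\<tau> z) * s z = c * szego_kernel \<alpha> z"
  by (simp add: pulled_kernel_def \<sigma>_\<tau> s_nonzero del: mem_ball)

lemma pulled_kernel_in_hardy_smirnov:
  assumes \<alpha>: "\<alpha> \<in> unit_disc"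
  shows "pulled_kernel c \<alpha> \<in> hardy_smirnov \<Omega> \<tau>"
proof (rule bounded_imp_in_hardy_smirnov)
  show "pulled_kernel c \<alpha> \<in> extensional \<Omega>"
    by (simp add: pulled_kernel_def)
  have "(\<lambda>z. c * szego_kernel \<alpha> z / s z) holomorphic_on unit_disc"
    using s_nonzero by (intro holomorphic_intros szego_kernel_holomorphic[OF \<alpha>] hol_s) auto
  then have "((\<lambda>z. c * szego_kernel \<alpha> z / s z) \<circ> \<sigma>) holomorphic_on \<Omega>"
    using \<sigma>_in by (intro holomorphic_on_compose_gen[OF hol_\<sigma>]) auto
  then show "pulled_kernel c \<alpha> holomorphic_on \<Omega>"
    by (rule holomorphic_transform) (simp add: pulled_kernel_def)
  show "norm (pulled_kernel c \<alpha> (\<tau> z) * s z) \<le> norm c * (1 / (1 - norm \<alpha>))"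
    if "z \<in> unit_disc" for z
    unfolding pulled_kernel_mult_s[OF that] norm_mult
    using szego_kernel_bounded[OF \<alpha> that] by (rule mult_left_mono) simp
qed

text \<open>\<open>V\<close> maps the explicit function to the Szego kernel, and injectivity
  identifies it with the value of \<open>inv_into\<close>.\<close>

lemma hs_V_inv_szego_kernel:
  assumes \<alpha>: "\<alpha> \<in> unit_disc"
  shows "hs_V_inv \<Omega> \<tau> s (szego_kernel \<alpha>) = pulled_kernel 1 \<alpha>"
proof -
  have "hs_V \<tau> s (pulled_kernel 1 \<alpha>) = szego_kernel \<alpha>"
    by (rule ext) (auto simp: hs_V_def pulled_kernel_mult_s szego_kernel_def restrict_def
        simp del: mem_ball)
  then show ?thesis
    unfolding hs_V_inv_def
    by (intro inv_into_f_eq inj_on_hs_V pulled_kernel_in_hardy_smirnov[OF \<alpha>])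
qed

text \<open>Evaluating \<open>V f\<close> at \<open>\<sigma> u\<close> yields
  \<open>f u * s (\<sigma> u)\<close>. The constant cancels the second factor; it is conjugated
  because the kernel stands in the conjugate-linear slot.\<close>

definition kernel :: "complex \<Rightarrow> complex \<Rightarrow> complex" where
  "kernel u = pulled_kernel (cnj (1 / s (\<sigma> u))) (\<sigma> u)"

lemma kernel_eq_hs_V_inv:
  assumes "u \<in> \<Omega>"
  shows "kernel u = (\<lambda>w\<in>\<Omega>. cnj (1 / s (\<sigma> u)) * hs_V_inv \<Omega> \<tau> s (szego_kernel (\<sigma> u)) w)"
  unfolding kernel_def hs_V_inv_szego_kernel[OF \<sigma>_in[OF assms]]
  by (auto simp: pulled_kernel_def fun_eq_iff)

lemma hs_V_kernel:
  assumes "z \<in> unit_disc"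
  shows "hs_V \<tau> s (kernel u) z = cnj (1 / s (\<sigma> u)) * szego_kernel (\<sigma> u) z"
  using assms unfolding kernel_def hs_V_def by (simp only: restrict_apply' pulled_kernel_mult_s)

lemma hs_inner_kernel:
  assumes f: "f \<in> hardy_smirnov \<Omega> \<tau>" and u: "u \<in> \<Omega>"
  shows "hs_inner \<tau> s f (kernel u) = f u" and "hs_inner \<tau> s (kernel u) f = cnj (f u)"
proof -
  have "hs_V \<tau> s f (\<sigma> u) = f u * s (\<sigma> u)"
    using \<sigma>_in[OF u] by (simp add: hs_V_def \<tau>_\<sigma>[OF u])
  then show "hs_inner \<tau> s f (kernel u) = f u" "hs_inner \<tau> s (kernel u) f = cnj (f u)"
    using hardy_inner_szego_kernel[OF hs_V_holomorphic[OF f] \<sigma>_in[OF u] hs_V_kernel[of _ u]]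
      s_nonzero[OF \<sigma>_in[OF u]]
    by (simp_all add: hs_inner_def)
qed

lemma kernel_reproducing:
  assumes u: "u \<in> \<Omega>"
  shows "is_reproducing_kernel \<Omega> \<tau> s u (kernel u)"
  using pulled_kernel_in_hardy_smirnov[OF \<sigma>_in[OF u]] hs_inner_kernel(1)[OF _ u]
  by (simp add: is_reproducing_kernel_def kernel_def)

text \<open>The inner product of \<open>kernel v\<close> with \<open>k\<close> is computed twice: by
  the property of \<open>k\<close> at \<open>u\<close>, and by that of \<open>kernel v\<close> at
  \<open>v\<close>. Hence the values of \<open>k\<close> are forced.\<close>

lemma reproducing_kernel_apply:
  assumes k: "is_reproducing_kernel \<Omega> \<tau> s u k" and v: "v \<in> \<Omega>"
  shows "k v = cnj (kernel v u)"
proof -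
  have "kernel v u = hs_inner \<tau> s (kernel v) k"
    using k kernel_reproducing[OF v] by (simp add: is_reproducing_kernel_def)
  also have "\<dots> = cnj (k v)"
    using k v by (intro hs_inner_kernel) (simp_all add: is_reproducing_kernel_def)
  finally show ?thesis
    by simp
qed

lemma is_reproducing_kernel_iff:
  assumes u: "u \<in> \<Omega>"
  shows "is_reproducing_kernel \<Omega> \<tau> s u k \<longleftrightarrow> k = kernel u"
proof
  assume k: "is_reproducing_kernel \<Omega> \<tau> s u k"
  show "k = kernel u"
  proof (rule extensionalityI)
    show "k \<in> extensional \<Omega>" "kernel u \<in> extensional \<Omega>"
      using k kernel_reproducing[OF u]
      by (simp_all add: is_reproducing_kernel_def hardy_smirnov_def)
    show "k w = kernel u w" if "w \<in> \<Omega>" for w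
      using reproducing_kernel_apply[OF k that]
        reproducing_kernel_apply[OF kernel_reproducing[OF u] that] by simp
  qed
qed (simp add: kernel_reproducing[OF u])

section \<open>Moebius Riemann maps\<close>

text \<open>Since division by 0 gives 0, the formula for \<tau> does not by itself exclude a pole in
  the disc. Continuity of \<tau> does: at a pole the numerator would be the limit of
  \<open>\<tau> w * (c * w + d)\<close>, hence 0 too, and the determinant would vanish.\<close>

lemma moebius_denominator_nonzero:
  assumes det: "a * d - b * c \<noteq> 0"
    and \<tau>: "\<And>z. z \<in> unit_disc \<Longrightarrow> \<tau> z = (a * z + b) / (c * z + d)"
    and z: "z \<in> unit_disc"
  shows "c * z + d \<noteq> 0"
proof
  assume 0: "c * z + d = 0"
  then have d: "d = - (c * z)"
    by (simp add: eq_neg_iff_add_eq_0 add.commute)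
  have "c \<noteq> 0"
    using d det by auto
  have "isCont \<tau> z"
    using holomorphic_on_imp_continuous_on[OF hol_\<tau>] z
    unfolding continuous_on_eq_continuous_at[OF open_ball] by (rule bspec)
  then have "((\<lambda>w. \<tau> w * (c * w + d)) \<longlongrightarrow> \<tau> z * (c * z + d)) (at z)"
    by (intro tendsto_intros) (simp add: isCont_def)
  \<comment> \<open>The denominator equals \<open>c * (w - z)\<close>, so it vanishes only at
    \<open>z\<close> itself.\<close>
  moreover have "\<forall>\<^sub>F w in at z. \<tau> w * (c * w + d) = a * w + b"
  proof -
    have "\<forall>\<^sub>F w in at z. w \<in> unit_disc - {z}"
      using z by (intro eventually_at_in_open) auto
    then show ?thesis
    proof eventually_elim
      case (elim w)
      have "c * w + d = c * (w - z)"
        by (simp add: d algebra_simps)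
      then have "c * w + d \<noteq> 0"
        using elim \<open>c \<noteq> 0\<close> by auto
      moreover have "\<tau> w = (a * w + b) / (c * w + d)"
        using elim by (intro \<tau>) auto
      ultimately show ?case
        by simp
    qed
  qed
  ultimately have "((\<lambda>w. a * w + b) \<longlongrightarrow> \<tau> z * (c * z + d)) (at z)"
    by (rule Lim_transform_eventually)
  moreover have "((\<lambda>w. a * w + b) \<longlongrightarrow> a * z + b) (at z)"
    by (intro tendsto_intros)
  ultimately have "a * z + b = 0"
    using LIM_unique 0 by (metis mult_zero_right)
  have "c * (a * z + b) - a * (c * z + d) = - (a * d - b * c)"
    by (simp add: algebra_simps)
  then show False
    using 0 \<open>a * z + b = 0\<close> det by simp
qed

text \<open>The inverse map is \<open>\<sigma> u = (d * u - b) / (a - c * u)\<close>. Inserting it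
  into the Szego kernel and clearing fractions gives this unexpanded denominator.\<close>

lemma kernel_moebius:
  assumes det: "a * d - b * c \<noteq> 0"
    and \<tau>: "\<And>z. z \<in> unit_disc \<Longrightarrow> \<tau> z = (a * z + b) / (c * z + d)"
    and u: "u \<in> \<Omega>" and w: "w \<in> \<Omega>"
  shows "kernel u w = of_real (norm (a * d - b * c)) /
    (cnj (a - c * u) * (a - c * w) - cnj (d * u - b) * (d * w - b))"
proof -
  define D where "D = a * d - b * c"
  \<comment> \<open>The value at 0 of \<open>s z * (c * z + d)\<close>, which turns out to be
    constant on the disc: the square root of \<open>D\<close> selected by the branch
    \<open>s\<close>.\<close>
  define \<delta> where "\<delta> = s 0 * d"
  have den: "c * z + d \<noteq> 0" if "z \<in> unit_disc" for z
    using moebius_denominator_nonzero[OF det \<tau> that] .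
  have deriv: "deriv \<tau> z = D / (c * z + d)\<^sup>2" if z: "z \<in> unit_disc" for z
  proof -
    have "((\<lambda>z. (a * z + b) / (c * z + d)) has_field_derivative D / (c * z + d)\<^sup>2) (at z)"
      using den[OF z]
      by (auto intro!: derivative_eq_intros simp: D_def power2_eq_square algebra_simps)
    then have "(\<tau> has_field_derivative D / (c * z + d)\<^sup>2) (at z)"
      by (rule has_field_derivative_transform_within_open[OF _ open_ball z]) (rule \<tau>[symmetric])
    then show ?thesis
      by (rule DERIV_imp_deriv)
  qed
  have square: "(s z * (c * z + d))\<^sup>2 = D" if "z \<in> unit_disc" for z
    using den[OF that] by (simp add: power_mult_distrib s_squared[OF that] deriv[OF that])
  have \<delta>: "\<delta>\<^sup>2 = D"
    using square[of 0] by (simp add: \<delta>_def)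
  \<comment> \<open>A continuous function on the disc with constant square is constant.\<close>
  have "(\<lambda>z. s z * (c * z + d)) constant_on unit_disc"
  proof (rule continuous_finite_range_constant)
    show "continuous_on unit_disc (\<lambda>z. s z * (c * z + d))"
      by (intro continuous_intros holomorphic_on_imp_continuous_on[OF hol_s])
    have "(\<lambda>z. s z * (c * z + d)) ` unit_disc \<subseteq> {\<delta>, - \<delta>}"
      using square unfolding \<delta>[symmetric] power2_eq_iff by fast
    then show "finite ((\<lambda>z. s z * (c * z + d)) ` unit_disc)"
      by (rule finite_subset) simp
  qed auto
  then obtain e where e: "\<And>z. z \<in> unit_disc \<Longrightarrow> s z * (c * z + d) = e"
    unfolding constant_on_def by blast
  have s_eq: "s z = \<delta> / (c * z + d)" if "z \<in> unit_disc" for z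
  proof -
    have "s z * (c * z + d) = s 0 * (c * 0 + d)"
      using e[OF that] e[of 0] by simp
    then show ?thesis
      using den[OF that] by (simp add: \<delta>_def field_simps)
  qed
  define p q where "p = c * \<sigma> u + d" and "q = c * \<sigma> w + d"
  have pq: "p \<noteq> 0" "q \<noteq> 0"
    using den \<sigma>_in u w by (auto simp: p_def q_def)
  have D: "D \<noteq> 0"
    using det by (simp add: D_def)
  have u_eq: "a - c * u = D / p" "d * u - b = \<sigma> u * D / p"
    using \<tau>[OF \<sigma>_in[OF u]] pq by (auto simp: \<tau>_\<sigma>[OF u] p_def D_def field_simps)
  have w_eq: "a - c * w = D / q" "d * w - b = \<sigma> w * D / q"
    using \<tau>[OF \<sigma>_in[OF w]] pq by (auto simp: \<tau>_\<sigma>[OF w] q_def D_def field_simps)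
  \<comment> \<open>The kernel involves \<delta> only through this product, so the choice of branch
    drops out.\<close>
  have norm_D: "of_real (norm D) = \<delta> * cnj \<delta>"
    unfolding \<delta>[symmetric] norm_power by (rule complex_norm_square)
  have "kernel u w = cnj p * q / (\<delta> * cnj \<delta> * (1 - cnj (\<sigma> u) * \<sigma> w))"
    using u w \<sigma>_in[OF u] \<sigma>_in[OF w]
    by (simp add: kernel_def pulled_kernel_def szego_kernel_def s_eq p_def q_def mult_ac)
  \<comment> \<open>The fraction is expanded by \<open>\<delta> * cnj \<delta>\<close>, using that
    \<open>D * cnj D\<close> is its square; the factors \<open>D\<close> are then absorbed by
    \<open>u_eq\<close> and \<open>w_eq\<close>.\<close>
  also have "\<dots> = \<delta> * cnj \<delta> / (D * cnj D * (1 - cnj (\<sigma> u) * \<sigma> w) / (cnj p * q))"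
    using D pq by (simp add: \<delta>[symmetric] power2_eq_square)
  also have "D * cnj D * (1 - cnj (\<sigma> u) * \<sigma> w) / (cnj p * q) =
      cnj (a - c * u) * (a - c * w) - cnj (d * u - b) * (d * w - b)"
    unfolding u_eq w_eq using pq by (simp add: field_simps)
  finally show ?thesis
    by (simp add: norm_D D_def[symmetric])
qed

end

theorem lemma3p1:
  fixes \<Omega> :: "complex set" and \<tau> s :: "complex \<Rightarrow> complex"
  assumes "open \<Omega>" and "simply_connected \<Omega>" and "\<Omega> \<noteq> UNIV"
    and "riemann_map \<tau> \<Omega>"
    and "sqrt_branch s \<tau>"
  shows "(\<forall>u\<in>\<Omega>. \<forall>k. is_reproducing_kernel \<Omega> \<tau> s u k \<longleftrightarrow>
            k = (\<lambda>w\<in>\<Omega>. cnj (1 / s (inv_into unit_disc \<tau> u)) *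
                   hs_V_inv \<Omega> \<tau> s (szego_kernel (inv_into unit_disc \<tau> u)) w)) \<and>
         (\<forall>a b c d :: complex.
            a * d - b * c \<noteq> 0 \<longrightarrow>
            (\<forall>z\<in>unit_disc. \<tau> z = (a * z + b) / (c * z + d)) \<longrightarrow>
            (\<forall>u\<in>\<Omega>. \<forall>k. is_reproducing_kernel \<Omega> \<tau> s u k \<longrightarrow>
               (\<forall>w\<in>\<Omega>. k w =
                  of_real (norm (a * d - b * c)) /
                  (of_real ((norm a)\<^sup>2) - of_real ((norm b)\<^sup>2) + (b * cnj d - cnj c * a) * cnj u
                   + ((of_real ((norm c)\<^sup>2) - of_real ((norm d)\<^sup>2)) * cnj u
                      + cnj b * d - cnj a * c) * w))))"
proof -
  interpret hardy_smirnov_domain \<Omega> \<tau> s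
    using assms by unfold_locales
  \<comment> \<open>Multiplying out takes the product form of the denominator to the stated one,
    with squared norms written as \<open>a * cnj a\<close> and so on.\<close>
  have den: "cnj (a - c * u) * (a - c * w) - cnj (d * u - b) * (d * w - b) =
      of_real ((norm a)\<^sup>2) - of_real ((norm b)\<^sup>2) + (b * cnj d - cnj c * a) * cnj u
      + ((of_real ((norm c)\<^sup>2) - of_real ((norm d)\<^sup>2)) * cnj u + cnj b * d - cnj a * c) * w"
    for a b c d u w :: complex
    unfolding complex_norm_square by (simp add: algebra_simps)
  show ?thesis
  proof (intro conjI ballI allI impI)
    fix u k assume "u \<in> \<Omega>"
    then show "is_reproducing_kernel \<Omega> \<tau> s u k \<longleftrightarrow>
        k = (\<lambda>w\<in>\<Omega>. cnj (1 / s (\<sigma> u)) * hs_V_inv \<Omega> \<tau> s (szego_kernel (\<sigma> u)) w)"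
      by (simp only: is_reproducing_kernel_iff kernel_eq_hs_V_inv)
  next
    fix a b c d u k w
    assume "a * d - b * c \<noteq> 0" "\<forall>z\<in>unit_disc. \<tau> z = (a * z + b) / (c * z + d)"
      and "u \<in> \<Omega>" "is_reproducing_kernel \<Omega> \<tau> s u k" "w \<in> \<Omega>"
    then have "k w = of_real (norm (a * d - b * c)) /
        (cnj (a - c * u) * (a - c * w) - cnj (d * u - b) * (d * w - b))"
      using kernel_moebius[of a d b c u w] by (metis is_reproducing_kernel_iff)
    then show "k w = of_real (norm (a * d - b * c)) /
        (of_real ((norm a)\<^sup>2) - of_real ((norm b)\<^sup>2) + (b * cnj d - cnj c * a) * cnj u
         + ((of_real ((norm c)\<^sup>2) - of_real ((norm d)\<^sup>2)) * cnj u + cnj b * d - cnj a * c) * w)"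
      unfolding den .
  qed
qed

end
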